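(* Let $K$ be an arbitrary field, let $n\geq 3$, and let $A$ be the free metabelian anticommutative algebra over $K$ with free generators $x_1,\ldots,x_n$. Then the endomorphism $$\tau=(x_1+(x_3x_2)x_1,\,x_2,\ldots,x_n)$$ of $A$, i.e. the one with $\tau(x_1)=x_1+(x_3x_2)x_1$ and $\tau(x_i)=x_i$ for $2\le i\le n$, is an absolutely wild automorphism of $A$.
   Context: Algebras are nonassociative and without required unit. An algebra over $K$ is anticommutative if it satisfies the identity $x^2=0$, and metabelian if it satisfies the identity $(xy)(zt)=0$. The free metabelian anticommutative algebra $A$ on $x_1,\ldots,x_n$ is the free algebra on these generators in the variety defined by these two identities. An endomorphism $\phi$ of $A$ is written as the tuple $(\phi(x_1),\ldots,\phi(x_n))$. An automorphism of $A$ is elementary if it has the form $(x_1,\ldots,x_{i-1},\alpha x_i+f,x_{i+1},\ldots,x_n)$ with $0\neq\alpha\in K$ and $f$ in the subalgebra generated by $\{x_1,\ldots,x_n\}\setminus\{x_i\}$. The tame automorphisms are the elements of the subgroup of $\mathrm{Aut}(A)$ generated by all elementary automorphisms. For $k\ge 1$, $A^{k}$ denotes the ideal of $A$ spanned by all products (with any bracketing) of at least $k$ elements of $A$. $\mathrm{IA}(k)$ denotes the set of all automorphisms of $A$ that induce the identity automorphism on $A/A^{k+1}$. An automorphism $\phi\in\mathrm{Aut}(A)$ is approximately tame if there is a sequence of tame automorphisms $\{\psi_k\}_{k\ge 0}$ such that $\phi\psi_k^{-1}\in\mathrm{IA}(k)$ for all $k$ (the condition for $k=0$ being vacuous). An automorphism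 is absolutely wild if it is not approximately tame. *)

theory Defs
  imports Complex_Main "HOL-Library.Poly_Mapping" "HOL-Algebra.Generated_Groups"
begin

section \<open>The free nonassociative algebra\<close>

datatype 'x magma = Gen 'x | Prod "'x magma" "'x magma"

text \<open>
  The free nonassociative algebra (without unit) over \<open>'k\<close> on the generators \<open>'x\<close> has the
  nonassociative monomials \<open>'x magma\<close> as a linear basis, so its elements are the finitely supported
  functions \<open>'x magma \<Rightarrow>\<^sub>0 'k\<close>. Every monomial factors in at most one way, so the coefficient of
  \<open>Prod s t\<close> in a product is a single product of coefficients.
\<close>

lift_definition fmult ::
  "('x magma \<Rightarrow>\<^sub>0 'k::field) \<Rightarrow> ('x magma \<Rightarrow>\<^sub>0 'k) \<Rightarrow> ('x magma \<Rightarrow>\<^sub>0 'k)"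
  is "\<lambda>p q m. case m of Gen i \<Rightarrow> 0 | Prod s t \<Rightarrow> p s * q t"
proof -
  fix p q :: "'x magma \<Rightarrow> 'k"
  assume fin: "finite {m. p m \<noteq> 0}" "finite {m. q m \<noteq> 0}"
  have "{m. (case m of Gen i \<Rightarrow> 0 | Prod s t \<Rightarrow> p s * q t) \<noteq> 0}
      \<subseteq> (\<lambda>(s, t). Prod s t) ` ({m. p m \<noteq> 0} \<times> {m. q m \<noteq> 0})"
    by (force split: magma.splits)
  then show "finite {m. (case m of Gen i \<Rightarrow> 0 | Prod s t \<Rightarrow> p s * q t) \<noteq> 0}"
    by (rule finite_subset) (use fin in auto)
qed

lift_definition fscale :: "'k::field \<Rightarrow> ('x magma \<Rightarrow>\<^sub>0 'k) \<Rightarrow> ('x magma \<Rightarrow>\<^sub>0 'k)"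
  is "\<lambda>c p m. c * p m"
  by (rule finite_subset) auto

lemma lookup_fmult:
  "Poly_Mapping.lookup (fmult p q) m = (case m of Gen i \<Rightarrow> 0 | Prod s t \<Rightarrow> Poly_Mapping.lookup p s * Poly_Mapping.lookup q t)"
  by transfer simp

lemma lookup_fscale: "Poly_Mapping.lookup (fscale c p) m = c * Poly_Mapping.lookup p m"
  by transfer simp

lemma fmult_add_left: "fmult (p + q) r = fmult p r + fmult q r"
  and fmult_add_right: "fmult r (p + q) = fmult r p + fmult r q"
  and fmult_diff_left: "fmult (p - q) r = fmult p r - fmult q r"
  and fmult_diff_right: "fmult r (p - q) = fmult r p - fmult r q"
  and fmult_scale_left: "fmult (fscale c p) r = fscale c (fmult p r)"
  and fmult_scale_right: "fmult r (fscale c p) = fscale c (fmult r p)"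
  by (auto intro!: poly_mapping_eqI
      simp: lookup_fmult lookup_fscale lookup_add lookup_minus algebra_simps split: magma.splits)

lemma fscale_simps:
  "fscale c (p + q) = fscale c p + fscale c q"
  "fscale c (p - q) = fscale c p - fscale c q"
  "fscale (c + d) p = fscale c p + fscale d p"
  "fscale c (fscale d p) = fscale (c * d) p"
  "fscale 1 p = p"
  "fscale (- 1) p = - p"
  by (auto intro!: poly_mapping_eqI simp: lookup_fscale lookup_add lookup_minus algebra_simps)

section \<open>The free metabelian anticommutative algebra\<close>

text \<open>
  The ideal of identities: the two-sided ideal generated by all values of \<open>u\<^sup>2\<close> and of
  \<open>(uv)(wz)\<close>, where \<open>u, v, w, z\<close> range over all elements and not only over monomials (the
  identity \<open>u\<^sup>2 = 0\<close> is not multilinear).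
\<close>

inductive_set id_ideal :: "('x magma \<Rightarrow>\<^sub>0 'k::field) set" where
  zero: "0 \<in> id_ideal"
| add: "p \<in> id_ideal \<Longrightarrow> q \<in> id_ideal \<Longrightarrow> p + q \<in> id_ideal"
| scale: "p \<in> id_ideal \<Longrightarrow> fscale c p \<in> id_ideal"
| mult_left: "p \<in> id_ideal \<Longrightarrow> fmult q p \<in> id_ideal"
| mult_right: "p \<in> id_ideal \<Longrightarrow> fmult p q \<in> id_ideal"
| anticommutative: "fmult u u \<in> id_ideal"
| metabelian: "fmult (fmult u v) (fmult w z) \<in> id_ideal"

lemma id_ideal_uminus: "p \<in> id_ideal \<Longrightarrow> - p \<in> id_ideal"
  using id_ideal.scale[of p "- 1"] by (simp add: fscale_simps)

lemma id_ideal_diff: "p \<in> id_ideal \<Longrightarrow> q \<in> id_ideal \<Longrightarrow> p - q \<in> id_ideal"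
  using id_ideal.add[of p "- q"] id_ideal_uminus[of q] by simp

definition id_cong :: "('x magma \<Rightarrow>\<^sub>0 'k::field) \<Rightarrow> ('x magma \<Rightarrow>\<^sub>0 'k) \<Rightarrow> bool" where
  "id_cong p q \<longleftrightarrow> p - q \<in> id_ideal"

lemma id_cong_trans: "id_cong p q \<Longrightarrow> id_cong q r \<Longrightarrow> id_cong p r"
  using id_ideal.add[of "p - q" "q - r"] by (simp add: id_cong_def)

quotient_type (overloaded) ('x, 'k) fma = "'x magma \<Rightarrow>\<^sub>0 'k::field" / id_cong
proof (rule equivpI)
  show "reflp id_cong"
    by (auto simp: reflp_def id_cong_def intro: id_ideal.zero)
  show "symp id_cong"
    unfolding symp_def id_cong_def by (metis id_ideal_uminus minus_diff_eq)
  show "transp id_cong"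
    unfolding transp_def by (blast intro: id_cong_trans)
qed

instantiation fma :: (type, field) ab_group_add
begin

lift_definition zero_fma :: "('a, 'b) fma" is 0 .

lift_definition plus_fma :: "('a, 'b) fma \<Rightarrow> ('a, 'b) fma \<Rightarrow> ('a, 'b) fma" is "(+)"
  unfolding id_cong_def by (simp add: add_diff_add id_ideal.add)

lift_definition minus_fma :: "('a, 'b) fma \<Rightarrow> ('a, 'b) fma \<Rightarrow> ('a, 'b) fma" is "(-)"
proof -
  fix p p' q q' :: "'a magma \<Rightarrow>\<^sub>0 'b"
  assume "id_cong p p'" "id_cong q q'"
  then have "(p - p') - (q - q') \<in> id_ideal"
    unfolding id_cong_def by (rule id_ideal_diff)
  then show "id_cong (p - q) (p' - q')"
    by (simp add: id_cong_def algebra_simps)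
qed

lift_definition uminus_fma :: "('a, 'b) fma \<Rightarrow> ('a, 'b) fma" is uminus
  unfolding id_cong_def by (metis id_ideal_uminus minus_diff_minus)

instance
  by standard
    (transfer; simp add: id_cong_def id_ideal.zero algebra_simps)+

end

instantiation fma :: (type, field) times
begin

lift_definition times_fma :: "('a, 'b) fma \<Rightarrow> ('a, 'b) fma \<Rightarrow> ('a, 'b) fma" is fmult
proof -
  fix p p' q q' :: "'a magma \<Rightarrow>\<^sub>0 'b"
  assume "id_cong p p'" "id_cong q q'"
  then have "fmult (p - p') q + fmult p' (q - q') \<in> id_ideal"
    by (auto simp: id_cong_def intro: id_ideal.intros)
  then show "id_cong (fmult p q) (fmult p' q')"
    by (simp add: id_cong_def fmult_diff_left fmult_diff_right)
qed

instance ..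

end

lift_definition scale :: "'k::field \<Rightarrow> ('x, 'k) fma \<Rightarrow> ('x, 'k) fma" (infixr "*\<^sub>A" 75) is fscale
  unfolding id_cong_def by (metis id_ideal.scale fscale_simps(2))

lift_definition gen :: "'x \<Rightarrow> ('x, 'k::field) fma" is "\<lambda>i. Poly_Mapping.single (Gen i) 1" .

lemma id_congI: "p = q \<Longrightarrow> id_cong p q"
  by (simp add: id_cong_def id_ideal.zero)

global_interpretation fma: vector_space scale
  by standard (transfer; rule id_congI; simp add: fscale_simps)+

lemma fma_distrib:
  fixes a b c :: "('x, 'k::field) fma"
  shows "(a + b) * c = a * c + b * c" "c * (a + b) = c * a + c * b"
  by (transfer; rule id_congI; simp add: fmult_add_left fmult_add_right)+

lemma fma_scale_mult:
  fixes a b :: "('x, 'k::field) fma"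
  shows "(r *\<^sub>A a) * b = r *\<^sub>A (a * b)" "a * (r *\<^sub>A b) = r *\<^sub>A (a * b)"
  by (transfer; rule id_congI; simp add: fmult_scale_left fmult_scale_right)+

lemma fma_anticommutative: "a * a = 0" for a :: "('x, 'k::field) fma"
  by transfer (simp add: id_cong_def id_ideal.anticommutative)

lemma fma_metabelian: "(a * b) * (c * d) = 0" for a b c d :: "('x, 'k::field) fma"
  by transfer (simp add: id_cong_def id_ideal.metabelian)

lemma fma_mult_zero [simp]:
  fixes a :: "('x, 'k::field) fma"
  shows "a * 0 = 0" "0 * a = 0"
  using fma_distrib(1)[of 0 0 a] fma_distrib(2)[of a 0 0] by simp_all

section \<open>Endomorphisms and automorphisms\<close>

definition endomorphism :: "(('x, 'k::field) fma \<Rightarrow> ('x, 'k) fma) \<Rightarrow> bool" where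
  "endomorphism \<phi> \<longleftrightarrow> (\<forall>a b. \<phi> (a + b) = \<phi> a + \<phi> b) \<and> (\<forall>c a. \<phi> (c *\<^sub>A a) = c *\<^sub>A \<phi> a)
     \<and> (\<forall>a b. \<phi> (a * b) = \<phi> a * \<phi> b)"

definition automorphism :: "(('x, 'k::field) fma \<Rightarrow> ('x, 'k) fma) \<Rightarrow> bool" where
  "automorphism \<phi> \<longleftrightarrow> endomorphism \<phi> \<and> bij \<phi>"

definition Aut :: "(('x, 'k::field) fma \<Rightarrow> ('x, 'k) fma) monoid" where
  "Aut = \<lparr>carrier = {\<phi>. automorphism \<phi>}, mult = (\<circ>), one = id\<rparr>"

primrec eval_monomial :: "('x \<Rightarrow> ('x, 'k::field) fma) \<Rightarrow> 'x magma \<Rightarrow> ('x, 'k) fma" where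
  "eval_monomial g (Gen i) = g i"
| "eval_monomial g (Prod s t) = eval_monomial g s * eval_monomial g t"

definition feval :: "('x \<Rightarrow> ('x, 'k::field) fma) \<Rightarrow> ('x magma \<Rightarrow>\<^sub>0 'k) \<Rightarrow> ('x, 'k) fma" where
  "feval g p = (\<Sum>m\<in>Poly_Mapping.keys p. Poly_Mapping.lookup p m *\<^sub>A eval_monomial g m)"

lemma feval_superset:
  assumes "finite S" "Poly_Mapping.keys p \<subseteq> S"
  shows "feval g p = (\<Sum>m\<in>S. Poly_Mapping.lookup p m *\<^sub>A eval_monomial g m)"
  unfolding feval_def using assms
  by (intro sum.mono_neutral_left) (auto simp: in_keys_iff)

lemma feval_add: "feval g (p + q) = feval g p + feval g q"
proof -
  let ?S = "Poly_Mapping.keys p \<union> Poly_Mapping.keys q"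
  have "feval g (p + q) = (\<Sum>m\<in>?S. Poly_Mapping.lookup (p + q) m *\<^sub>A eval_monomial g m)"
    by (rule feval_superset) (use keys_add[of p q] in auto)
  also have "\<dots> = feval g p + feval g q"
    by (simp add: feval_superset[of ?S] lookup_add fma.scale_left_distrib sum.distrib)
  finally show ?thesis .
qed

lemma feval_scale: "feval g (fscale c p) = c *\<^sub>A feval g p"
proof -
  have "feval g (fscale c p) = (\<Sum>m\<in>Poly_Mapping.keys p. Poly_Mapping.lookup (fscale c p) m *\<^sub>A eval_monomial g m)"
    by (rule feval_superset) (auto simp: in_keys_iff lookup_fscale)
  then show ?thesis
    by (simp add: feval_def lookup_fscale fma.scale_sum_right)
qed

lemma feval_diff: "feval g (p - q) = feval g p - feval g q"
  using feval_add[of g "p - q" q] by (simp add: algebra_simps)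

lemma fma_sum_mult:
  fixes a :: "('x, 'k::field) fma"
  shows "(\<Sum>i\<in>S. f i) * a = (\<Sum>i\<in>S. f i * a)" "a * (\<Sum>i\<in>S. f i) = (\<Sum>i\<in>S. a * f i)"
  by (induction S rule: infinite_finite_induct) (simp_all add: fma_distrib)

lemma feval_mult: "feval g (fmult p q) = feval g p * feval g q"
proof -
  let ?P = "\<lambda>(s, t). Prod s t"
  have "feval g (fmult p q)
      = (\<Sum>m\<in>?P ` (Poly_Mapping.keys p \<times> Poly_Mapping.keys q). Poly_Mapping.lookup (fmult p q) m *\<^sub>A eval_monomial g m)"
    by (rule feval_superset) (force simp: in_keys_iff lookup_fmult split: magma.splits)+
  also have "\<dots> = (\<Sum>(s, t)\<in>Poly_Mapping.keys p \<times> Poly_Mapping.keys q.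
      (Poly_Mapping.lookup p s * Poly_Mapping.lookup q t) *\<^sub>A (eval_monomial g s * eval_monomial g t))"
    by (subst sum.reindex) (auto simp: inj_on_def lookup_fmult intro!: sum.cong)
  also have "\<dots> = feval g p * feval g q"
    unfolding feval_def fma_sum_mult(1) unfolding fma_sum_mult(2)
    by (simp add: fma_scale_mult mult.commute flip: sum.cartesian_product)
  finally show ?thesis .
qed

lemma feval_id_ideal: "p \<in> id_ideal \<Longrightarrow> feval g p = 0"
proof (induction rule: id_ideal.induct)
  case zero
  show ?case by (simp add: feval_def)
qed (simp_all add: feval_add feval_scale feval_mult fma_anticommutative fma_metabelian)

text \<open>
  \<open>endo g\<close> is the endomorphism given by the tuple \<open>g\<close> of the images of the generators.
\<close>

lift_definition endo :: "('x \<Rightarrow> ('x, 'k::field) fma) \<Rightarrow> ('x, 'k) fma \<Rightarrow> ('x, 'k) fma" is feval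
  using feval_id_ideal unfolding id_cong_def by (metis feval_diff eq_iff_diff_eq_0)

lemma endo_gen [simp]: "endo g (gen i) = g i"
  by (transfer fixing: g) (simp add: feval_def)

lemma endomorphism_endo: "endomorphism (endo g)"
  unfolding endomorphism_def
  by (intro conjI allI; transfer fixing: g) (simp_all add: feval_add feval_scale feval_mult)

lemma endomorphism_unique:
  assumes \<phi>: "endomorphism \<phi>" and \<psi>: "endomorphism \<psi>" and gens: "\<And>i. \<phi> (gen i) = \<psi> (gen i)"
  shows "\<phi> = \<psi>"
proof
  fix a
  have monomial: "\<phi> (abs_fma (Poly_Mapping.single m 1)) = \<psi> (abs_fma (Poly_Mapping.single m 1))" for m
  proof (induction m)
    case (Gen i)
    then show ?case using gens[of i] by (simp add: gen.abs_eq)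
  next
    case (Prod s t)
    have "Poly_Mapping.single (Prod s t) 1
        = fmult (Poly_Mapping.single s 1) (Poly_Mapping.single t (1::'b))"
      by (rule poly_mapping_eqI) (auto simp: lookup_fmult lookup_single when_def split: magma.splits)
    then have "abs_fma (Poly_Mapping.single (Prod s t) (1::'b))
        = abs_fma (Poly_Mapping.single s 1) * abs_fma (Poly_Mapping.single t 1)"
      by (simp add: times_fma.abs_eq)
    then show ?case using Prod \<phi> \<psi> by (simp add: endomorphism_def)
  qed
  have "\<phi> (abs_fma p) = \<psi> (abs_fma p)" for p
  proof (induction p rule: update_induct)
    case const
    then show ?case using \<phi> \<psi> by (metis endomorphism_def fma.scale_zero_left zero_fma.abs_eq)
  next
    case (update p m c)
    have "Poly_Mapping.update m c p = p + Poly_Mapping.single m c"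
      using update(1) by (intro poly_mapping_eqI)
        (auto simp: lookup_update lookup_add lookup_single when_def in_keys_iff)
    moreover
    have "Poly_Mapping.single m c = fscale c (Poly_Mapping.single m 1)"
      by (rule poly_mapping_eqI) (simp add: lookup_fscale lookup_single when_def)
    ultimately have "abs_fma (Poly_Mapping.update m c p)
        = abs_fma p + c *\<^sub>A abs_fma (Poly_Mapping.single m 1)"
      by (simp add: scale.abs_eq plus_fma.abs_eq)
    then show ?case using update(3) monomial \<phi> \<psi> by (simp add: endomorphism_def)
  qed
  then show "\<phi> a = \<psi> a"
    by (induction a rule: fma.abs_induct)
qed

lemma endomorphism_comp:
  "endomorphism \<phi> \<Longrightarrow> endomorphism \<psi> \<Longrightarrow> endomorphism (\<phi> \<circ> \<psi>)"
  by (simp add: endomorphism_def)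

lemma automorphism_inv: "automorphism \<phi> \<Longrightarrow> automorphism (inv_into UNIV \<phi>)"
  unfolding automorphism_def endomorphism_def
  by (auto simp: bij_imp_bij_inv bij_is_inj bij_is_surj inv_f_eq surj_f_inv_f)

lemma group_Aut: "group Aut"
proof (rule groupI)
  fix \<phi> :: "('x, 'k::field) fma \<Rightarrow> ('x, 'k) fma"
  assume "\<phi> \<in> carrier Aut"
  then have "automorphism \<phi>" by (simp add: Aut_def)
  then have "inv_into UNIV \<phi> \<in> carrier Aut" "inv_into UNIV \<phi> \<otimes>\<^bsub>Aut\<^esub> \<phi> = \<one>\<^bsub>Aut\<^esub>"
    using automorphism_inv[of \<phi>] by (auto simp: Aut_def automorphism_def bij_is_inj)
  then show "\<exists>\<psi>\<in>carrier Aut. \<psi> \<otimes>\<^bsub>Aut\<^esub> \<phi> = \<one>\<^bsub>Aut\<^esub>" by blast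
next
  show "\<one>\<^bsub>Aut\<^esub> \<in> carrier (Aut :: (('x, 'k::field) fma \<Rightarrow> ('x, 'k) fma) monoid)"
    by (simp add: Aut_def automorphism_def endomorphism_def)
next
  fix \<phi> \<psi> :: "('x, 'k::field) fma \<Rightarrow> ('x, 'k) fma"
  assume "\<phi> \<in> carrier Aut" "\<psi> \<in> carrier Aut"
  then show "\<phi> \<otimes>\<^bsub>Aut\<^esub> \<psi> \<in> carrier Aut"
    by (simp add: Aut_def automorphism_def endomorphism_comp bij_comp)
qed (simp_all add: Aut_def comp_assoc)

section \<open>Tame and absolutely wild automorphisms\<close>

definition subalgebra :: "('x, 'k::field) fma set \<Rightarrow> bool" where
  "subalgebra B \<longleftrightarrow> fma.subspace B \<and> (\<forall>a\<in>B. \<forall>b\<in>B. a * b \<in> B)"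

definition elementary :: "(('x, 'k::field) fma \<Rightarrow> ('x, 'k) fma) \<Rightarrow> bool" where
  "elementary \<phi> \<longleftrightarrow> automorphism \<phi> \<and>
     (\<exists>i \<alpha> f. \<alpha> \<noteq> 0 \<and> f \<in> subalgebra hull (range gen - {gen i}) \<and>
        \<phi> = endo (gen(i := \<alpha> *\<^sub>A gen i + f)))"

definition tame :: "(('x, 'k::field) fma \<Rightarrow> ('x, 'k) fma) \<Rightarrow> bool" where
  "tame \<phi> \<longleftrightarrow> \<phi> \<in> generate Aut {\<psi>. elementary \<psi>}"

text \<open>\<open>is_product k a\<close>: \<open>a\<close> is a product, with some bracketing, of exactly \<open>k\<close> elements.\<close>

inductive is_product :: "nat \<Rightarrow> ('x, 'k::field) fma \<Rightarrow> bool" where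
  single: "is_product 1 a"
| mult: "is_product k a \<Longrightarrow> is_product l b \<Longrightarrow> is_product (k + l) (a * b)"

definition alg_power :: "nat \<Rightarrow> ('x, 'k::field) fma set" where
  "alg_power k = fma.span {a. \<exists>m\<ge>k. is_product m a}"

lemma alg_power_ideal:
  assumes "a \<in> alg_power k"
  shows "a * b \<in> alg_power k" "b * a \<in> alg_power k"
proof -
  have "a * b \<in> alg_power k \<and> b * a \<in> alg_power k"
    using assms unfolding alg_power_def
  proof (induction rule: fma.span_induct_alt)
    case base
    then show ?case by (simp add: fma.span_zero)
  next
    case (step c x y)
    from step(1) obtain m where m: "m \<ge> k" "is_product m x" by blast
    have "is_product (m + 1) (x * b)" "is_product (1 + m) (b * x)"
      using m(2) by (blast intro: is_product.intros)+
    moreover have "m + 1 \<ge> k" "1 + m \<ge> k" using m(1) by simp_all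
    ultimately have "x * b \<in> {a. \<exists>m\<ge>k. is_product m a} \<and> b * x \<in> {a. \<exists>m\<ge>k. is_product m a}"
      by blast
    then show ?case using step(2)
      by (simp add: fma_distrib fma_scale_mult fma.span_add fma.span_scale fma.span_base)
  qed
  then show "a * b \<in> alg_power k" "b * a \<in> alg_power k" by simp_all
qed

lemma alg_power_1: "alg_power 1 = UNIV"
proof -
  have "a \<in> alg_power 1" for a :: "('x, 'k::field) fma"
    unfolding alg_power_def by (rule fma.span_base) (blast intro: is_product.single)
  then show ?thesis by blast
qed

text \<open>
  \<open>\<phi>\<close> induces the identity on the quotient by \<open>A\<^sup>k\<^sup>+\<^sup>1\<close> iff \<open>\<phi> a\<close> and \<open>a\<close> are congruent
  modulo \<open>A\<^sup>k\<^sup>+\<^sup>1\<close> for all \<open>a\<close>.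
\<close>

definition IA :: "nat \<Rightarrow> (('x, 'k::field) fma \<Rightarrow> ('x, 'k) fma) set" where
  "IA k = {\<phi>. automorphism \<phi> \<and> (\<forall>a. \<phi> a - a \<in> alg_power (k + 1))}"

definition approximately_tame :: "(('x, 'k::field) fma \<Rightarrow> ('x, 'k) fma) \<Rightarrow> bool" where
  "approximately_tame \<phi> \<longleftrightarrow> automorphism \<phi> \<and>
     (\<exists>\<psi>. \<forall>k. tame (\<psi> k) \<and> \<phi> \<otimes>\<^bsub>Aut\<^esub> inv\<^bsub>Aut\<^esub> (\<psi> k) \<in> IA k)"

definition absolutely_wild :: "(('x, 'k::field) fma \<Rightarrow> ('x, 'k) fma) \<Rightarrow> bool" where
  "absolutely_wild \<phi> \<longleftrightarrow> automorphism \<phi> \<and> \<not> approximately_tame \<phi>"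

end

theory Submission
  imports Defs
begin

text \<open>
  The obstruction is the determinant of the Jacobian matrix of an automorphism, computed with
  coefficients in the dual numbers \<open>K[\<epsilon>]/(\<epsilon>\<^sup>2)\<close>, where the right multiplication by \<open>a\<close> acts
  as \<open>\<epsilon> \<lambda>(a)\<close> for a linear form \<open>\<lambda>\<close> on \<open>A\<close>. Its \<open>\<epsilon>\<close>-part, divided by its constant part, is a
  trace \<open>T\<^sub>\<lambda>(\<phi>)\<close> satisfying the cocycle identity
  \<open>T\<^sub>\<lambda>(\<phi>\<psi>) = T\<^sub>\<lambda>(\<phi>) + T\<^bsub>\<lambda>\<phi>\<^esub>(\<psi>)\<close>. An elementary automorphism has a Jacobian matrix with constant
  determinant, so \<open>T\<^sub>\<lambda>\<close> vanishes on tame automorphisms for every \<open>\<lambda>\<close>. If \<open>\<lambda>\<close> reads off the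
  coefficient of \<open>x\<^sub>3x\<^sub>2\<close>, then \<open>T\<^sub>\<lambda>(\<phi>)\<close> depends only on \<open>\<phi>\<close> modulo \<open>A\<^sup>4\<close>, and
  \<open>T\<^sub>\<lambda>(\<tau>) = -1\<close>.
\<close>

section \<open>Linear forms\<close>

definition linear_form :: "(('x, 'k::field) fma \<Rightarrow> 'k) \<Rightarrow> bool" where
  "linear_form l \<longleftrightarrow> (\<forall>a b. l (a + b) = l a + l b) \<and> (\<forall>c a. l (c *\<^sub>A a) = c * l a)"

lemma linear_formD:
  assumes "linear_form l"
  shows "l (a + b) = l a + l b" "l (c *\<^sub>A a) = c * l a" "l 0 = 0" "l (a - b) = l a - l b"
proof -
  show add: "l (a + b) = l a + l b" for a b
    using assms by (simp add: linear_form_def)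
  show scale: "l (c *\<^sub>A a) = c * l a" for c a
    using assms by (simp add: linear_form_def)
  show "l 0 = 0"
    using scale[of 0 0] by simp
  show "l (a - b) = l a - l b"
    using add[of "a - b" b] by simp
qed

lemma linear_form_comp:
  "linear_form l \<Longrightarrow> endomorphism \<phi> \<Longrightarrow> linear_form (l \<circ> \<phi>)"
  by (simp add: linear_form_def endomorphism_def)

lemma endo_gen_id: "endo gen = id"
  by (rule endomorphism_unique[OF endomorphism_endo]) (simp_all add: endomorphism_def)

text \<open>Since \<open>endo gen\<close> is the identity, every element is a linear combination of
  monomials in the generators; \<open>0\<close> arises by scaling a generator.\<close>

lemma fma_induct [case_names gen add scale mult]:
  fixes a :: "('x, 'k::field) fma"
  assumes gen: "\<And>i. P (gen i)"
    and add: "\<And>a b. P a \<Longrightarrow> P b \<Longrightarrow> P (a + b)"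
    and scale: "\<And>c a. P a \<Longrightarrow> P (c *\<^sub>A a)"
    and mult: "\<And>a b. P a \<Longrightarrow> P b \<Longrightarrow> P (a * b)"
  shows "P a"
proof -
  have zero: "P 0"
    using scale[OF gen, of 0] by simp
  have monomial: "P (eval_monomial gen m)" for m
    by (induction m) (simp_all add: gen mult)
  have "P (\<Sum>m\<in>S. c m *\<^sub>A eval_monomial gen m)" for c and S :: "'x magma set"
    by (induction S rule: infinite_finite_induct) (simp_all add: zero add scale monomial)
  then have "P (endo gen a)"
    by (induction a rule: fma.abs_induct) (simp add: endo.abs_eq feval_def)
  then show ?thesis
    by (simp add: endo_gen_id)
qed

lemma feval_gen: "feval gen p = abs_fma p"
  by (metis endo.abs_eq endo_gen_id id_apply)

section \<open>Linear forms with prescribed values on generators and products\<close>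

definition free_form ::
  "('x \<Rightarrow> 'k) \<Rightarrow> (('x, 'k::field) fma \<Rightarrow> ('x, 'k) fma \<Rightarrow> 'k) \<Rightarrow> ('x magma \<Rightarrow>\<^sub>0 'k) \<Rightarrow> 'k" where
  "free_form g B p = (\<Sum>m\<in>Poly_Mapping.keys p. Poly_Mapping.lookup p m *
     (case m of Gen i \<Rightarrow> g i | Prod s t \<Rightarrow> B (eval_monomial gen s) (eval_monomial gen t)))"

definition admissible :: "(('x, 'k::field) fma \<Rightarrow> ('x, 'k) fma \<Rightarrow> 'k) \<Rightarrow> bool" where
  "admissible B \<longleftrightarrow> (\<forall>a. linear_form (B a)) \<and> (\<forall>b. linear_form (\<lambda>a. B a b)) \<and>
     (\<forall>a. B a a = 0) \<and> (\<forall>a b c d. B (a * b) (c * d) = 0)"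

text \<open>
  \<open>A\<close> has a unique linear form with the values \<open>g i\<close> on generators and \<open>B a b\<close> on products,
  because admissibility says that \<open>B\<close> respects the two identities.
\<close>

definition form :: "('x \<Rightarrow> 'k) \<Rightarrow> (('x, 'k::field) fma \<Rightarrow> ('x, 'k) fma \<Rightarrow> 'k) \<Rightarrow> ('x, 'k) fma \<Rightarrow> 'k" where
  "form g B a = free_form g B (rep_fma a)"

lemma free_form_superset:
  assumes "finite S" "Poly_Mapping.keys p \<subseteq> S"
  shows "free_form g B p = (\<Sum>m\<in>S. Poly_Mapping.lookup p m *
     (case m of Gen i \<Rightarrow> g i | Prod s t \<Rightarrow> B (eval_monomial gen s) (eval_monomial gen t)))"
  unfolding free_form_def using assms
  by (intro sum.mono_neutral_left) (auto simp: in_keys_iff)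

lemma free_form_add: "free_form g B (p + q) = free_form g B p + free_form g B q"
proof -
  let ?S = "Poly_Mapping.keys p \<union> Poly_Mapping.keys q"
  have "free_form g B (p + q) = (\<Sum>m\<in>?S. Poly_Mapping.lookup (p + q) m *
     (case m of Gen i \<Rightarrow> g i | Prod s t \<Rightarrow> B (eval_monomial gen s) (eval_monomial gen t)))"
    by (rule free_form_superset) (use keys_add[of p q] in auto)
  also have "\<dots> = free_form g B p + free_form g B q"
    by (simp add: free_form_superset[of ?S] lookup_add distrib_right sum.distrib)
  finally show ?thesis .
qed

lemma free_form_scale: "free_form g B (fscale c p) = c * free_form g B p"
proof -
  have "free_form g B (fscale c p) = (\<Sum>m\<in>Poly_Mapping.keys p. Poly_Mapping.lookup (fscale c p) m *
     (case m of Gen i \<Rightarrow> g i | Prod s t \<Rightarrow> B (eval_monomial gen s) (eval_monomial gen t)))"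
    by (rule free_form_superset) (auto simp: in_keys_iff lookup_fscale)
  then show ?thesis
    by (simp add: free_form_def lookup_fscale sum_distrib_left mult.assoc)
qed

lemma free_form_diff: "free_form g B (p - q) = free_form g B p - free_form g B q"
  using free_form_add[of g B "p - q" q] by (simp add: algebra_simps)

lemma linear_form_sum:
  assumes "linear_form l"
  shows "l (\<Sum>m\<in>S. c m *\<^sub>A f m) = (\<Sum>m\<in>S. c m * l (f m))"
  by (induction S rule: infinite_finite_induct) (simp_all add: linear_formD[OF assms])

text \<open>A monomial splits uniquely at its root, so the sum runs over pairs of monomials and
  factors by bilinearity of \<open>B\<close>.\<close>

lemma free_form_mult:
  assumes B: "admissible B"
  shows "free_form g B (fmult p q) = B (abs_fma p) (abs_fma q)"
proof -
  let ?P = "\<lambda>(s, t). Prod s t"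
  have "free_form g B (fmult p q)
      = (\<Sum>m\<in>?P ` (Poly_Mapping.keys p \<times> Poly_Mapping.keys q). Poly_Mapping.lookup (fmult p q) m *
     (case m of Gen i \<Rightarrow> g i | Prod s t \<Rightarrow> B (eval_monomial gen s) (eval_monomial gen t)))"
    by (rule free_form_superset) (force simp: in_keys_iff lookup_fmult split: magma.splits)+
  also have "\<dots> = (\<Sum>(s, t)\<in>Poly_Mapping.keys p \<times> Poly_Mapping.keys q.
      Poly_Mapping.lookup p s * (Poly_Mapping.lookup q t * B (eval_monomial gen s) (eval_monomial gen t)))"
    by (subst sum.reindex) (auto simp: inj_on_def lookup_fmult mult.assoc intro!: sum.cong)
  also have "\<dots> = (\<Sum>s\<in>Poly_Mapping.keys p. Poly_Mapping.lookup p s * B (eval_monomial gen s) (feval gen q))"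
    using B by (simp add: feval_def admissible_def linear_form_sum sum_distrib_left
        flip: sum.cartesian_product)
  also have "\<dots> = B (feval gen p) (feval gen q)"
    unfolding feval_def[of gen p]
    using B by (intro linear_form_sum[symmetric]) (simp add: admissible_def)
  finally show ?thesis
    by (simp add: feval_gen)
qed

text \<open>A factor from the ideal has class 0 in the algebra, so bilinearity settles its products;
  the two identities are covered by the other two clauses of admissibility.\<close>

lemma free_form_id_ideal:
  assumes B: "admissible B"
  shows "p \<in> id_ideal \<Longrightarrow> free_form g B p = 0"
proof (induction rule: id_ideal.induct)
  case zero
  show ?case by (simp add: free_form_def)
next
  case (mult_left p q)
  then have "abs_fma p = 0"
    using feval_id_ideal[of p gen] by (simp add: feval_gen)
  then show ?case
    using B by (simp add: free_form_mult admissible_def linear_formD)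
next
  case (mult_right p q)
  then have "abs_fma p = 0"
    using feval_id_ideal[of p gen] by (simp add: feval_gen)
  then show ?case
    using B linear_formD(3)[of "\<lambda>a. B a (abs_fma q)"] by (simp add: free_form_mult admissible_def)
next
  case (anticommutative u)
  then show ?case
    using B by (simp add: free_form_mult admissible_def)
next
  case (metabelian u v w z)
  then show ?case
    using B by (simp add: free_form_mult admissible_def flip: times_fma.abs_eq)
qed (simp_all add: free_form_add free_form_scale)

lemma form_abs:
  assumes "admissible B"
  shows "form g B (abs_fma p) = free_form g B p"
proof -
  have "id_cong (rep_fma (abs_fma p)) p"
    by (metis Quotient3_fma rep_abs_rsp_left id_cong_def id_ideal.zero diff_self)
  then show ?thesis
    using free_form_id_ideal[OF assms] unfolding form_def id_cong_def
    by (metis free_form_diff eq_iff_diff_eq_0)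
qed

lemma form:
  assumes B: "admissible B"
  shows linear_form_form: "linear_form (form g B)"
    and form_gen: "form g B (gen i) = g i"
    and form_mult: "form g B (a * b) = B a b"
proof -
  show "linear_form (form g B)"
    unfolding linear_form_def
  proof (intro conjI allI)
    show "form g B (a + b) = form g B a + form g B b" for a b
      by (induction a rule: fma.abs_induct, induction b rule: fma.abs_induct)
        (simp add: plus_fma.abs_eq form_abs[OF B] free_form_add)
    show "form g B (c *\<^sub>A a) = c * form g B a" for c a
      by (induction a rule: fma.abs_induct) (simp add: scale.abs_eq form_abs[OF B] free_form_scale)
  qed
  show "form g B (gen i) = g i"
    by (simp add: gen.abs_eq form_abs[OF B] free_form_def)
  show "form g B (a * b) = B a b"
    by (induction a rule: fma.abs_induct, induction b rule: fma.abs_induct)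
      (simp add: times_fma.abs_eq form_abs[OF B] free_form_mult[OF B])
qed

section \<open>The Jacobian matrix over the dual numbers\<close>

definition lin :: "'x \<Rightarrow> ('x, 'k::field) fma \<Rightarrow> 'k" where
  "lin i = form (\<lambda>j. if j = i then 1 else 0) (\<lambda>a b. 0)"

text \<open>The partial derivative of \<open>a\<close> is \<open>lin i a + \<epsilon> diff l i a\<close>.\<close>

definition diff :: "(('x, 'k::field) fma \<Rightarrow> 'k) \<Rightarrow> 'x \<Rightarrow> ('x, 'k) fma \<Rightarrow> 'k" where
  "diff l i = form (\<lambda>j. 0) (\<lambda>a b. lin i a * l b - lin i b * l a)"

lemma
  fixes a b :: "('x, 'k::field) fma"
  shows linear_form_lin: "linear_form (lin i :: ('x, 'k) fma \<Rightarrow> 'k)"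
    and lin_gen [simp]: "lin i (gen j :: ('x, 'k) fma) = (if j = i then 1 else 0)"
    and lin_mult [simp]: "lin i (a * b) = 0"
proof -
  have "admissible (\<lambda>a b :: ('x, 'k) fma. 0)"
    by (simp add: admissible_def linear_form_def)
  from form[OF this] show "linear_form (lin i :: ('x, 'k) fma \<Rightarrow> 'k)"
    "lin i (gen j :: ('x, 'k) fma) = (if j = i then 1 else 0)" "lin i (a * b) = 0"
    by (simp_all add: lin_def)
qed

lemmas lin_linear = linear_formD[OF linear_form_lin]

text \<open>Leibniz rule: the derivative of \<open>a * b\<close> is that of \<open>a\<close>
  followed by right multiplication by \<open>b\<close>, minus the same with \<open>a\<close> and
  \<open>b\<close> exchanged. Such a multiplication carries a factor \<epsilon>, so only the
  constant parts \<open>lin i a\<close> and \<open>lin i b\<close> survive.\<close>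

lemma
  assumes l: "linear_form l"
  shows linear_form_diff: "linear_form (diff l i)"
    and diff_gen: "diff l i (gen j) = 0"
    and diff_mult: "diff l i (a * b) = lin i a * l b - lin i b * l a"
proof -
  have "admissible (\<lambda>a b. lin i a * l b - lin i b * l a)"
    by (simp add: admissible_def linear_form_def lin_linear linear_formD[OF l] algebra_simps)
  from form[OF this] show "linear_form (diff l i)" "diff l i (gen j) = 0"
    "diff l i (a * b) = lin i a * l b - lin i b * l a"
    by (simp_all add: diff_def)
qed

section \<open>Chain rule for the Jacobian matrix\<close>

lemma lin_chain:
  fixes \<phi> :: "('x, 'k::field) fma \<Rightarrow> ('x, 'k) fma"
  assumes fin: "finite (UNIV :: 'x set)" and \<phi>: "endomorphism \<phi>"
  shows "lin i (\<phi> a) = (\<Sum>j\<in>UNIV. lin i (\<phi> (gen j)) * lin j a)"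
proof (induction a rule: fma_induct)
  case (gen k)
  then show ?case
    using fin by (simp add: if_distrib[of "(*) _"] cong: if_cong)
qed (use \<phi> in \<open>simp_all add: endomorphism_def lin_linear distrib_left sum.distrib sum_distrib_left
    mult.left_commute\<close>)

text \<open>Applying \<open>\<phi>\<close> turns right multiplication by \<open>b\<close> into right
  multiplication by \<open>\<phi> b\<close>, hence the twisted form \<open>l \<circ> \<phi>\<close>.
  The summands form the \<epsilon>-part of a matrix product over the dual numbers.\<close>

lemma diff_chain:
  fixes \<phi> :: "('x, 'k::field) fma \<Rightarrow> ('x, 'k) fma"
  assumes fin: "finite (UNIV :: 'x set)" and \<phi>: "endomorphism \<phi>" and l: "linear_form l"
  shows "diff l i (\<phi> a) = (\<Sum>j\<in>UNIV. lin i (\<phi> (gen j)) * diff (l \<circ> \<phi>) j a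
    + diff l i (\<phi> (gen j)) * lin j a)"
proof -
  define l' where "l' = l \<circ> \<phi>"
  have l': "linear_form l'"
    unfolding l'_def using l \<phi> by (rule linear_form_comp)
  note D = linear_formD[OF linear_form_diff[OF l]] linear_formD[OF linear_form_diff[OF l']]
    diff_gen[OF l] diff_gen[OF l'] diff_mult[OF l] diff_mult[OF l']
  show ?thesis
    unfolding l'_def[symmetric]
  proof (induction a rule: fma_induct)
    case (gen k)
    then show ?case
      using fin by (simp add: D if_distrib[of "(*) _"] cong: if_cong)
  next
    case (mult a b)
    have "diff l i (\<phi> (a * b)) = lin i (\<phi> a) * l' b - lin i (\<phi> b) * l' a"
      using \<phi> by (simp add: endomorphism_def D l'_def)
    then show ?case
      by (simp add: D lin_chain[OF fin \<phi>, of i a] lin_chain[OF fin \<phi>, of i b]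
          sum_distrib_right sum_distrib_left sum_subtractf algebra_simps)
  qed (use \<phi> in \<open>simp_all add: endomorphism_def D lin_linear algebra_simps sum.distrib
      sum_distrib_left\<close>)
qed

text \<open>
  If \<open>\<psi>\<close> is the inverse of \<open>\<phi>\<close> and \<open>J\<^sub>0 + \<epsilon>J\<^sub>1\<close> is the Jacobian matrix of \<open>\<phi>\<close>, then
  \<open>jtrace l \<phi> \<psi>\<close> is the trace of \<open>J\<^sub>0\<^sup>-\<^sup>1J\<^sub>1\<close>.
\<close>

definition jtrace :: "(('x, 'k::field) fma \<Rightarrow> 'k) \<Rightarrow> (('x, 'k) fma \<Rightarrow> ('x, 'k) fma) \<Rightarrow>
    (('x, 'k) fma \<Rightarrow> ('x, 'k) fma) \<Rightarrow> 'k" where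
  "jtrace l \<phi> \<psi> = (\<Sum>i\<in>UNIV. \<Sum>j\<in>UNIV. lin j (\<psi> (gen i)) * diff l i (\<phi> (gen j)))"

text \<open>For Jacobian matrices \<open>J0 + \<epsilon> J1\<close> of \<open>\<phi>\<close> and,
  with the twisted form, \<open>K0 + \<epsilon> K1\<close> of \<open>\<psi>\<close>, the matrix for
  the composite is \<open>K0^-1 (J0^-1 J1) K0 + K0^-1 K1\<close>, and the trace ignores
  conjugation.\<close>

lemma jtrace_comp:
  fixes \<phi> :: "('x, 'k::field) fma \<Rightarrow> ('x, 'k) fma"
  assumes fin: "finite (UNIV :: 'x set)"
    and endo: "endomorphism \<phi>" "endomorphism \<phi>'" "endomorphism \<psi>" "endomorphism \<psi>'"
    and inv: "\<And>a. \<phi>' (\<phi> a) = a" "\<And>a. \<psi> (\<psi>' a) = a"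
    and l: "linear_form l"
  shows "jtrace l (\<phi> \<circ> \<psi>) (\<psi>' \<circ> \<phi>') = jtrace l \<phi> \<phi>' + jtrace (l \<circ> \<phi>) \<psi> \<psi>'"
proof -
  \<comment> \<open>The entry in row \<open>k\<close> and column \<open>i\<close> of
    \<open>K0^-1 J0^-1\<close>. Fact \<open>A\<close> cancels \<open>J0\<close>, fact
    \<open>B\<close> cancels \<open>K0\<close>.\<close>
  define p where "p i k = lin k (\<psi>' (\<phi>' (gen i)))" for i k
  have A: "(\<Sum>i\<in>UNIV. p i j * lin i (\<phi> (gen k))) = lin j (\<psi>' (gen k))" for j k
  proof -
    have "lin j ((\<psi>' \<circ> \<phi>') (\<phi> (gen k))) = (\<Sum>i\<in>UNIV. p i j * lin i (\<phi> (gen k)))"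
      unfolding p_def comp_apply[of \<psi>' \<phi>', symmetric]
      by (rule lin_chain[OF fin endomorphism_comp[OF endo(4,2)]])
    then show ?thesis by (simp only: comp_apply inv)
  qed
  have B: "(\<Sum>j\<in>UNIV. p i j * lin k (\<psi> (gen j))) = lin k (\<phi>' (gen i))" for i k
  proof -
    have "lin k (\<psi> (\<psi>' (\<phi>' (gen i)))) = (\<Sum>j\<in>UNIV. lin k (\<psi> (gen j)) * p i j)"
      unfolding p_def by (rule lin_chain[OF fin endo(3)])
    then show ?thesis by (simp only: inv mult.commute)
  qed
  have "p i j * diff l i (\<phi> (\<psi> (gen j)))
      = (\<Sum>k\<in>UNIV. p i j * lin i (\<phi> (gen k)) * diff (l \<circ> \<phi>) k (\<psi> (gen j)))
      + (\<Sum>k\<in>UNIV. p i j * lin k (\<psi> (gen j)) * diff l i (\<phi> (gen k)))" for i j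
    unfolding diff_chain[OF fin endo(1) l, of i "\<psi> (gen j)"] sum_distrib_left sum.distrib[symmetric]
    by (rule sum.cong[OF refl]) (simp only: distrib_left mult_ac)
  then have "jtrace l (\<phi> \<circ> \<psi>) (\<psi>' \<circ> \<phi>')
      = (\<Sum>i\<in>UNIV. \<Sum>j\<in>UNIV. \<Sum>k\<in>UNIV. p i j * lin i (\<phi> (gen k)) * diff (l \<circ> \<phi>) k (\<psi> (gen j)))
      + (\<Sum>i\<in>UNIV. \<Sum>j\<in>UNIV. \<Sum>k\<in>UNIV. p i j * lin k (\<psi> (gen j)) * diff l i (\<phi> (gen k)))"
    unfolding jtrace_def comp_apply p_def[symmetric] by (simp only: sum.distrib)
  also have "(\<Sum>i\<in>UNIV. \<Sum>j\<in>UNIV. \<Sum>k\<in>UNIV. p i j * lin i (\<phi> (gen k)) * diff (l \<circ> \<phi>) k (\<psi> (gen j)))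
      = (\<Sum>k\<in>UNIV. \<Sum>j\<in>UNIV. (\<Sum>i\<in>UNIV. p i j * lin i (\<phi> (gen k))) * diff (l \<circ> \<phi>) k (\<psi> (gen j)))"
  proof -
    have "(\<Sum>i\<in>UNIV. \<Sum>j\<in>UNIV. \<Sum>k\<in>UNIV. f i j k) = (\<Sum>k\<in>UNIV. \<Sum>j\<in>UNIV. \<Sum>i\<in>UNIV. f i j k)"
      for f :: "'x \<Rightarrow> 'x \<Rightarrow> 'x \<Rightarrow> 'k"
    proof -
      have "(\<Sum>i\<in>UNIV. \<Sum>j\<in>UNIV. \<Sum>k\<in>UNIV. f i j k) = (\<Sum>i\<in>UNIV. \<Sum>k\<in>UNIV. \<Sum>j\<in>UNIV. f i j k)"
        by (rule sum.cong[OF refl], rule sum.swap)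
      also have "\<dots> = (\<Sum>k\<in>UNIV. \<Sum>i\<in>UNIV. \<Sum>j\<in>UNIV. f i j k)"
        by (rule sum.swap)
      also have "\<dots> = (\<Sum>k\<in>UNIV. \<Sum>j\<in>UNIV. \<Sum>i\<in>UNIV. f i j k)"
        by (rule sum.cong[OF refl], rule sum.swap)
      finally show ?thesis .
    qed
    then show ?thesis
      by (simp add: sum_distrib_right)
  qed
  also have "\<dots> = jtrace (l \<circ> \<phi>) \<psi> \<psi>'"
    by (simp add: A jtrace_def)
  also have "(\<Sum>i\<in>UNIV. \<Sum>j\<in>UNIV. \<Sum>k\<in>UNIV. p i j * lin k (\<psi> (gen j)) * diff l i (\<phi> (gen k)))
      = (\<Sum>i\<in>UNIV. \<Sum>k\<in>UNIV. (\<Sum>j\<in>UNIV. p i j * lin k (\<psi> (gen j))) * diff l i (\<phi> (gen k)))"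
    unfolding sum_distrib_right by (rule sum.cong[OF refl], rule sum.swap)
  also have "\<dots> = jtrace l \<phi> \<phi>'"
    by (simp add: B jtrace_def)
  finally show ?thesis
    by (simp only: add.commute)
qed

section \<open>Tame automorphisms\<close>

text \<open>The derivative by \<open>gen i\<close> is zero on the other generators, and the Leibniz
  rule keeps it zero on products once \<open>lin i\<close> is carried along.\<close>

lemma subalgebra_hull_vanish:
  assumes "f \<in> subalgebra hull (range gen - {gen i})" and l: "linear_form l"
  shows "lin i f = 0 \<and> diff l i f = 0"
proof -
  have D: "linear_form (diff l i)" by (rule linear_form_diff[OF l])
  have "subalgebra {f. lin i f = 0 \<and> diff l i f = 0}"
    unfolding subalgebra_def fma.subspace_def
    by (simp add: lin_linear linear_formD[OF D] diff_mult[OF l])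
  moreover have "range gen - {gen i} \<subseteq> {f. lin i f = 0 \<and> diff l i f = 0}"
    by (auto simp: diff_gen[OF l])
  ultimately have "subalgebra hull (range gen - {gen i}) \<subseteq> {f. lin i f = 0 \<and> diff l i f = 0}"
    by (simp add: hull_minimal)
  then show ?thesis
    using assms(1) by blast
qed

text \<open>Every summand vanishes: the \<epsilon>-part lives in column \<open>i\<close> with
  diagonal entry 0, while \<open>\<psi>\<close> fixes the other generators, so row \<open>i\<close>
  of its linear part is zero off the diagonal.\<close>

lemma jtrace_elementary:
  fixes \<phi> :: "('x, 'k::field) fma \<Rightarrow> ('x, 'k) fma"
  assumes "elementary \<phi>" and inv: "\<And>a. \<psi> (\<phi> a) = a" and l: "linear_form l"
  shows "jtrace l \<phi> \<psi> = 0"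
proof -
  obtain i \<alpha> f where f: "f \<in> subalgebra hull (range gen - {gen i})"
    and \<phi>: "\<phi> = endo (gen(i := \<alpha> *\<^sub>A gen i + f))"
    using assms(1) unfolding elementary_def by blast
  have "lin j (\<psi> (gen k)) * diff l k (\<phi> (gen j)) = 0" for j k
  proof (cases "j = i")
    case False
    then show ?thesis by (simp add: \<phi> diff_gen[OF l])
  next
    case True
    have "\<psi> (gen k) = gen k" if "k \<noteq> i"
      using inv[of "gen k"] that by (simp add: \<phi>)
    moreover have "diff l i (\<phi> (gen i)) = 0"
      using subalgebra_hull_vanish[OF f l] linear_formD[OF linear_form_diff[OF l]]
      by (simp add: \<phi> diff_gen[OF l])
    ultimately show ?thesis
      using True by (cases "k = i") auto
  qed
  then show ?thesis
    by (simp only: jtrace_def sum.neutral_const)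
qed

lemma Aut_simps:
  "\<phi> \<in> carrier Aut \<longleftrightarrow> automorphism \<phi>" "\<phi> \<otimes>\<^bsub>Aut\<^esub> \<psi> = \<phi> \<circ> \<psi>" "\<one>\<^bsub>Aut\<^esub> = id"
  by (simp_all add: Aut_def)

lemma Aut_inv:
  assumes "automorphism \<phi>"
  shows "automorphism (inv\<^bsub>Aut\<^esub> \<phi>)" "(inv\<^bsub>Aut\<^esub> \<phi>) (\<phi> a) = a" "\<phi> ((inv\<^bsub>Aut\<^esub> \<phi>) a) = a"
proof -
  interpret group Aut by (rule group_Aut)
  have "\<phi> \<in> carrier Aut" using assms by (simp add: Aut_simps)
  then have "inv\<^bsub>Aut\<^esub> \<phi> \<in> carrier Aut" "inv\<^bsub>Aut\<^esub> \<phi> \<otimes>\<^bsub>Aut\<^esub> \<phi> = \<one>\<^bsub>Aut\<^esub>" "\<phi> \<otimes>\<^bsub>Aut\<^esub> inv\<^bsub>Aut\<^esub> \<phi> = \<one>\<^bsub>Aut\<^esub>"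
    by simp_all
  then show "automorphism (inv\<^bsub>Aut\<^esub> \<phi>)" "(inv\<^bsub>Aut\<^esub> \<phi>) (\<phi> a) = a" "\<phi> ((inv\<^bsub>Aut\<^esub> \<phi>) a) = a"
    by (simp_all add: Aut_simps fun_eq_iff)
qed

lemma tame_automorphism: "tame \<phi> \<Longrightarrow> automorphism \<phi>"
proof -
  interpret group Aut by (rule group_Aut)
  assume "tame \<phi>"
  moreover have "{\<psi>. elementary \<psi>} \<subseteq> carrier Aut"
    by (auto simp: Aut_simps elementary_def)
  ultimately have "\<phi> \<in> carrier Aut"
    unfolding tame_def using generate_in_carrier by blast
  then show ?thesis by (simp add: Aut_simps)
qed

text \<open>The form must vary in the induction, because the cocycle identity twists it for the
  second factor.\<close>

lemma jtrace_tame: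
  fixes \<phi> :: "('x, 'k::field) fma \<Rightarrow> ('x, 'k) fma"
  assumes fin: "finite (UNIV :: 'x set)" and "tame \<phi>" and "linear_form l"
  shows "jtrace l \<phi> (inv\<^bsub>Aut\<^esub> \<phi>) = 0"
proof -
  interpret group "Aut :: (('x, 'k) fma \<Rightarrow> ('x, 'k) fma) monoid" by (rule group_Aut)
  from assms(2,3) show ?thesis
    unfolding tame_def
  proof (induction \<phi> arbitrary: l rule: generate.induct)
    case one
    then show ?case
      unfolding inv_one by (simp add: Aut_simps jtrace_def diff_gen)
  next
    case (incl h)
    then have "automorphism h" by (simp add: elementary_def)
    with incl show ?case
      by (intro jtrace_elementary) (simp_all add: Aut_inv)
  next
    case (inv h)
    then have h: "automorphism h" by (simp add: elementary_def)
    let ?g = "inv\<^bsub>Aut\<^esub> h"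
    have e: "endomorphism h" "endomorphism ?g"
      using h Aut_inv(1)[OF h] by (simp_all add: automorphism_def)
    \<comment> \<open>The cocycle identity for this composite reduces the inverse of an elementary
      automorphism to the automorphism itself.\<close>
    have "?g \<circ> h = id"
      using Aut_inv(2)[OF h] by auto
    then have "jtrace l ?g h + jtrace (l \<circ> ?g) h ?g = jtrace l id id"
      using jtrace_comp[OF fin e(2,1,1,2) Aut_inv(3)[OF h] Aut_inv(3)[OF h] inv(2)] by simp
    also have "\<dots> = 0"
      by (simp add: jtrace_def diff_gen[OF inv(2)])
    also have "jtrace (l \<circ> ?g) h ?g = 0"
      using inv Aut_inv(2)[OF h] linear_form_comp[OF inv(2) e(2)] by (intro jtrace_elementary) auto
    finally show ?case
      using h by (simp add: Aut_simps)
  next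
    case (eng h1 h2)
    have h: "automorphism h1" "automorphism h2"
      using eng(1,2) tame_automorphism unfolding tame_def by blast+
    then have e: "endomorphism h1" "endomorphism (inv\<^bsub>Aut\<^esub> h1)" "endomorphism h2" "endomorphism (inv\<^bsub>Aut\<^esub> h2)"
      using Aut_inv(1)[of h1] Aut_inv(1)[of h2] by (simp_all add: automorphism_def)
    have "inv\<^bsub>Aut\<^esub> (h1 \<otimes>\<^bsub>Aut\<^esub> h2) = inv\<^bsub>Aut\<^esub> h2 \<otimes>\<^bsub>Aut\<^esub> inv\<^bsub>Aut\<^esub> h1"
      using h by (intro inv_mult_group) (simp_all add: Aut_simps)
    then have "jtrace l (h1 \<otimes>\<^bsub>Aut\<^esub> h2) (inv\<^bsub>Aut\<^esub> (h1 \<otimes>\<^bsub>Aut\<^esub> h2))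
        = jtrace l (h1 \<circ> h2) (inv\<^bsub>Aut\<^esub> h2 \<circ> inv\<^bsub>Aut\<^esub> h1)"
      by (simp add: Aut_simps)
    also have "\<dots> = jtrace l h1 (inv\<^bsub>Aut\<^esub> h1) + jtrace (l \<circ> h1) h2 (inv\<^bsub>Aut\<^esub> h2)"
      using Aut_inv[OF h(1)] Aut_inv[OF h(2)] eng(5) by (intro jtrace_comp fin e) simp_all
    also have "\<dots> = 0"
      unfolding eng(3)[OF eng(5)] eng(4)[OF linear_form_comp[OF eng(5) e(1)]] by simp
    finally show ?case .
  qed
qed

section \<open>The wild automorphism\<close>

text \<open>For distinct \<open>i\<close> and \<open>j\<close>, the coefficient of
  \<open>gen i * gen j\<close>; anticommutativity makes it a 2 by 2 determinant of linear
  coefficients.\<close>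

definition coeff2 :: "'x \<Rightarrow> 'x \<Rightarrow> ('x, 'k::field) fma \<Rightarrow> 'k" where
  "coeff2 i j = form (\<lambda>_. 0) (\<lambda>a b. lin i a * lin j b - lin j a * lin i b)"

lemma
  fixes a b :: "('x, 'k::field) fma"
  shows linear_form_coeff2: "linear_form (coeff2 i j :: ('x, 'k) fma \<Rightarrow> 'k)"
    and coeff2_gen: "coeff2 i j (gen k :: ('x, 'k) fma) = 0"
    and coeff2_mult: "coeff2 i j (a * b) = lin i a * lin j b - lin j a * lin i b"
proof -
  have "admissible (\<lambda>a b :: ('x, 'k) fma. lin i a * lin j b - lin j a * lin i b)"
    by (simp add: admissible_def linear_form_def lin_linear algebra_simps)
  from form[OF this] show "linear_form (coeff2 i j :: ('x, 'k) fma \<Rightarrow> 'k)"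
    "coeff2 i j (gen k :: ('x, 'k) fma) = 0"
    "coeff2 i j (a * b) = lin i a * lin j b - lin j a * lin i b"
    by (simp_all add: coeff2_def)
qed

section \<open>Vanishing of the forms on powers of the algebra\<close>

lemma linear_form_alg_power:
  assumes "linear_form l" and "\<And>m a. m \<ge> k \<Longrightarrow> is_product m a \<Longrightarrow> l a = 0" and "a \<in> alg_power k"
  shows "l a = 0"
  using assms(3) unfolding alg_power_def
  by (induction rule: fma.span_induct_alt) (use assms(2) in \<open>auto simp: linear_formD[OF assms(1)]\<close>)

lemma is_product_split:
  assumes "is_product m a" "m \<ge> 2"
  obtains b c k l where "a = b * c" "is_product k b" "is_product l c" "m = k + l"
  using assms by (cases rule: is_product.cases) auto

lemma lin_is_product: "is_product m a \<Longrightarrow> m \<ge> 2 \<Longrightarrow> lin i a = 0"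
  by (erule is_product_split) simp_all

lemma coeff2_is_product:
  assumes "is_product m a" "m \<ge> 3"
  shows "coeff2 i j a = 0"
proof -
  obtain b c k l where a: "a = b * c" "is_product k b" "is_product l c" "m = k + l"
    using is_product_split[OF assms(1)] assms(2) by (metis Suc_1 Suc_leD eval_nat_numeral(3))
  then have "k \<ge> 2 \<or> l \<ge> 2"
    using assms(2) by arith
  then show ?thesis
    using lin_is_product[OF a(2)] lin_is_product[OF a(3)] by (auto simp: a(1) coeff2_mult)
qed

text \<open>Either both factors have length at least 2 and are killed by \<open>lin\<close>, or one
  has length at least 3 and is killed by both \<open>lin\<close> and \<open>coeff2\<close>.\<close>

lemma diff_coeff2_is_product:
  assumes "is_product m a" "m \<ge> 4"
  shows "diff (coeff2 p q) i a = 0"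
proof -
  have "m \<ge> 2" using assms(2) by simp
  then obtain b c k l where a: "a = b * c" "is_product k b" "is_product l c" "m = k + l"
    using is_product_split[OF assms(1)] by metis
  then have "k \<ge> 2 \<and> l \<ge> 2 \<or> k \<ge> 3 \<or> l \<ge> 3"
    using assms(2) by arith
  then show ?thesis
    using lin_is_product[OF a(2)] lin_is_product[OF a(3)]
      coeff2_is_product[OF a(2)] coeff2_is_product[OF a(3)]
    by (auto simp: a(1) diff_mult[OF linear_form_coeff2])
qed

lemma endo_simps:
  "endo g (a + b) = endo g a + endo g b" "endo g (c *\<^sub>A a) = c *\<^sub>A endo g a"
  "endo g (a * b) = endo g a * endo g b"
  using endomorphism_endo[of g] by (simp_all add: endomorphism_def)

text \<open>The inverse of \<open>\<tau> c\<close> is \<open>\<tau> (- c)\<close>: \<open>u\<close>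
  is fixed, and \<open>u * (u * gen i)\<close> vanishes by the metabelian identity because
  \<open>u\<close> is a product.\<close>

lemma automorphism_transvection:
  fixes u :: "('x, 'k::field) fma"
  assumes \<tau>: "\<And>c. \<tau> c = endo (gen(i := gen i + c *\<^sub>A (u * gen i)))"
    and fix_u: "\<And>c. \<tau> c u = u" and u: "u = v * w"
  shows "automorphism (\<tau> c)"
proof -
  have endo: "endomorphism (\<tau> d)" for d
    by (simp add: \<tau> endomorphism_endo)
  have "\<tau> d \<circ> \<tau> (- d) = id" for d
  proof (rule endomorphism_unique)
    show "endomorphism (\<tau> d \<circ> \<tau> (- d))"
      by (intro endomorphism_comp endo)
    show "endomorphism (id :: ('x, 'k) fma \<Rightarrow> _)"
      by (simp add: endomorphism_def)
    fix j
    have "u * (u * gen i) = 0"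
      using fma_metabelian[of v w u "gen i"] by (simp add: u)
    moreover have "\<tau> d (gen i) = gen i + d *\<^sub>A (u * gen i)"
      by (simp add: \<tau>)
    moreover have "\<tau> d (gen i + (- d) *\<^sub>A (u * gen i))
        = \<tau> d (gen i) + (- d) *\<^sub>A (\<tau> d u * \<tau> d (gen i))"
      by (simp only: \<tau>[of d] endo_simps)
    ultimately have "\<tau> d (gen i + (- d) *\<^sub>A (u * gen i)) = gen i"
      by (simp add: fix_u fma_distrib fma_scale_mult)
    moreover have "\<tau> d (gen j) = gen j" if "j \<noteq> i"
      using that by (simp add: \<tau>)
    ultimately show "(\<tau> d \<circ> \<tau> (- d)) (gen j) = id (gen j)"
      by (cases "j = i") (simp_all add: \<tau>[of "- d"])
  qed
  from this[of c] this[of "- c"] have "bij (\<tau> c)"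
    by (intro o_bij[of "\<tau> (- c)"]) simp_all
  then show ?thesis
    by (simp add: automorphism_def endo)
qed

text \<open>Modulo the fourth power, \<open>\<psi>\<close> has the Jacobian matrix of the
  transvection, whose trace is -1, whereas tameness forces 0.\<close>

lemma not_tame_mod_4:
  fixes \<psi> :: "('x, 'k::field) fma \<Rightarrow> ('x, 'k) fma"
  assumes fin: "finite (UNIV :: 'x set)" and "tame \<psi>"
    and distinct: "p \<noteq> i" "q \<noteq> i" "p \<noteq> q"
    and cong: "\<And>j. (gen(i := gen i + (gen p * gen q) * gen i)) j - \<psi> (gen j) \<in> alg_power 4"
  shows False
proof -
  let ?g = "gen(i := gen i + (gen p * gen q) * gen i)"
  let ?l = "coeff2 p q :: ('x, 'k) fma \<Rightarrow> 'k"
  let ?\<psi>' = "inv\<^bsub>Aut\<^esub> \<psi>"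
  note l = linear_form_coeff2[of p q]
  have \<psi>: "automorphism \<psi>" by (rule tame_automorphism[OF assms(2)])
  have lin: "lin k (\<psi> (gen j)) = (if j = k then 1 else 0)" for j k
  proof -
    have "lin k (?g j - \<psi> (gen j)) = 0"
      by (rule linear_form_alg_power[OF linear_form_lin _ cong]) (simp add: lin_is_product)
    then show ?thesis
      by (auto simp: lin_linear split: if_splits)
  qed
  \<comment> \<open>The -1 is the Leibniz term
    \<open>- lin i (gen i) * ?l (gen p * gen q)\<close>.\<close>
  have diff: "diff ?l k (\<psi> (gen j)) = (if j = i \<and> k = i then - 1 else 0)" for j k
  proof -
    have "diff ?l k (?g j - \<psi> (gen j)) = 0"
      by (rule linear_form_alg_power[OF linear_form_diff[OF l] _ cong])
        (simp add: diff_coeff2_is_product)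
    then show ?thesis using distinct
      by (auto simp: linear_formD[OF linear_form_diff[OF l]] diff_gen[OF l] diff_mult[OF l]
          coeff2_mult coeff2_gen split: if_splits)
  qed
  \<comment> \<open>The inverse of \<open>\<psi>\<close> is not explicit; the chain rule yields the
    one entry of its linear part that meets the nonzero entry of the \<epsilon>-part.\<close>
  have "lin i (\<psi> (?\<psi>' (gen i))) = (\<Sum>j\<in>UNIV. lin i (\<psi> (gen j)) * lin j (?\<psi>' (gen i)))"
    using \<psi> by (intro lin_chain[OF fin]) (simp add: automorphism_def)
  then have "lin i (?\<psi>' (gen i)) = 1"
    using fin by (simp add: Aut_inv[OF \<psi>] lin if_distrib[of "\<lambda>x. x * _"] cong: if_cong)
  moreover have "jtrace ?l \<psi> ?\<psi>' = (\<Sum>k\<in>UNIV. if k = i then - lin i (?\<psi>' (gen k)) else 0)"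
    unfolding jtrace_def
    using fin by (intro sum.cong) (simp_all add: diff if_distrib[of "(*) _"] cong: if_cong)
  ultimately have "jtrace ?l \<psi> ?\<psi>' = - 1"
    using fin by simp
  then show False
    using jtrace_tame[OF fin assms(2) l] by simp
qed

theorem theorem1:
  fixes n :: nat and e :: "nat \<Rightarrow> 'x" and x :: "nat \<Rightarrow> ('x, 'k::field) fma"
    and \<tau> :: "('x, 'k) fma \<Rightarrow> ('x, 'k) fma"
  assumes "n \<ge> 3"
    and "bij_betw e {1..n} UNIV"
    and "\<And>i. x i = gen (e i)"
    and "\<tau> = endo (gen(e 1 := x 1 + (x 3 * x 2) * x 1))"
  shows "absolutely_wild \<tau>"
proof -
  have fin: "finite (UNIV :: 'x set)"
    using assms(2) bij_betw_finite by blast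
  have distinct: "e 3 \<noteq> e 1" "e 2 \<noteq> e 1" "e 3 \<noteq> e 2"
    using assms(1) bij_betw_imp_inj_on[OF assms(2)] by (auto dest!: inj_onD)
  define u :: "('x, 'k) fma" where "u = gen (e 3) * gen (e 2)"
  \<comment> \<open>A one-parameter family containing \<open>\<tau>\<close> at \<open>c = 1\<close>
    and its inverse at \<open>c = -1\<close>.\<close>
  define t where "t c = endo (gen(e 1 := gen (e 1) + c *\<^sub>A (u * gen (e 1))))" for c
  have "t c u = u" for c
    using distinct by (simp add: t_def u_def endo_simps)
  then have "automorphism (t 1)"
    by (rule automorphism_transvection[OF t_def _ u_def])
  moreover have \<tau>: "\<tau> = endo (gen(e 1 := gen (e 1) + (gen (e 3) * gen (e 2)) * gen (e 1)))"
    by (simp add: assms(3,4))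
  ultimately have "automorphism \<tau>"
    by (simp add: t_def u_def)
  moreover have "\<not> approximately_tame \<tau>"
  proof
    assume "approximately_tame \<tau>"
    \<comment> \<open>The index 3 gives congruence modulo \<open>alg_power 4\<close>, the precision
      at which the trace is determined.\<close>
    then obtain \<psi> where \<psi>: "tame \<psi>" "\<tau> \<otimes>\<^bsub>Aut\<^esub> inv\<^bsub>Aut\<^esub> \<psi> \<in> IA 3"
      unfolding approximately_tame_def by blast
    have "\<tau> ((inv\<^bsub>Aut\<^esub> \<psi>) a) - a \<in> alg_power 4" for a
      using \<psi>(2) by (simp add: IA_def Aut_simps)
    \<comment> \<open>Evaluating at \<open>\<psi> (gen j)\<close> cancels the inverse.\<close>
    from this[of "\<psi> (gen j)" for j] have "\<tau> (gen j) - \<psi> (gen j) \<in> alg_power 4" for j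
      by (simp add: Aut_inv[OF tame_automorphism[OF \<psi>(1)]])
    then show False
      unfolding \<tau> endo_gen by (rule not_tame_mod_4[OF fin \<psi>(1) distinct])
  qed
  ultimately show ?thesis
    by (simp add: absolutely_wild_def)
qed

end
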